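(* Let $G$ be a torsion-free group with identity element $e$ and let $R$ be a unital commutative $G$-graded ring whose $G$-grading is non-degenerate. If $R_e$ is a domain, then every unit in $R$ is homogeneous, $R$ is an integral domain and every idempotent in $R$ is trivial.
   Context: A ring $R$ is $G$-graded if there is a collection $\{R_g\}_{g\in G}$ of additive subgroups of $R$ such that $R=\oplus_{g\in G}R_g$ and $R_gR_h\subseteq R_{gh}$ for all $g,h\in G$. A nonzero element of $R$ is homogeneous if it belongs to $R_g$ for some $g\in G$. The $G$-grading is non-degenerate if, for each $g\in G$ and each nonzero $r_g\in R_g$, we have $r_gR_{g^{-1}}\neq\{0\}$ and $R_{g^{-1}}r_g\neq\{0\}$. A domain is a nonzero ring in which the product of any two nonzero elements is nonzero. An idempotent is trivial if it equals $0$ or $1_R$. *)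

theory Defs
  imports "HOL-Algebra.Algebra"
begin

definition torsion_free_group :: "('g, 'm) monoid_scheme \<Rightarrow> bool" where
  "torsion_free_group G \<longleftrightarrow> group G \<and>
     (\<forall>g\<in>carrier G. \<forall>n::nat. 0 < n \<longrightarrow> g [^]\<^bsub>G\<^esub> n = \<one>\<^bsub>G\<^esub> \<longrightarrow> g = \<one>\<^bsub>G\<^esub>)"

definition support_of ::
    "('g, 'm) monoid_scheme \<Rightarrow> ('r, 'n) ring_scheme \<Rightarrow> ('g \<Rightarrow> 'r) \<Rightarrow> 'g set" where
  "support_of G R f = {g \<in> carrier G. f g \<noteq> \<zero>\<^bsub>R\<^esub>}"

text \<open>
  The product \<open>Rg g <#>\<^bsub>R\<^esub> Rg h\<close> is the set of pairwise products; since \<open>Rg (g h)\<close> is closed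
  under addition, it does not matter whether finite sums of such products are included.
  In \<open>direct_sum\<close>, the sum is taken over the support because \<open>finsum\<close> over an infinite index
  set is a junk value; \<open>\<Pi>\<^sub>E\<close> (rather than \<open>\<Pi>\<close>) makes functions outside \<open>carrier G\<close>
  irrelevant for uniqueness.
\<close>

locale graded_ring = group G + ring R
  for G :: "('g, 'm) monoid_scheme" and R :: "('r, 'n) ring_scheme" +
  fixes Rg :: "'g \<Rightarrow> 'r set"
  assumes component_subgroup: "g \<in> carrier G \<Longrightarrow> additive_subgroup (Rg g) R"
    and direct_sum: "r \<in> carrier R \<Longrightarrow>
      \<exists>!f. f \<in> (\<Pi>\<^sub>E g\<in>carrier G. Rg g) \<and> finite (support_of G R f) \<and>
           r = (\<Oplus>\<^bsub>R\<^esub>g\<in>support_of G R f. f g)"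
    and component_mult: "\<lbrakk>g \<in> carrier G; h \<in> carrier G\<rbrakk> \<Longrightarrow>
      Rg g <#>\<^bsub>R\<^esub> Rg h \<subseteq> Rg (g \<otimes>\<^bsub>G\<^esub> h)"

definition homogeneous ::
    "('g, 'm) monoid_scheme \<Rightarrow> ('r, 'n) ring_scheme \<Rightarrow> ('g \<Rightarrow> 'r set) \<Rightarrow> 'r \<Rightarrow> bool" where
  "homogeneous G R Rg r \<longleftrightarrow> r \<in> carrier R \<and> r \<noteq> \<zero>\<^bsub>R\<^esub> \<and> (\<exists>g\<in>carrier G. r \<in> Rg g)"

definition nondegenerate_grading ::
    "('g, 'm) monoid_scheme \<Rightarrow> ('r, 'n) ring_scheme \<Rightarrow> ('g \<Rightarrow> 'r set) \<Rightarrow> bool" where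
  "nondegenerate_grading G R Rg \<longleftrightarrow>
     (\<forall>g\<in>carrier G. \<forall>r\<in>Rg g. r \<noteq> \<zero>\<^bsub>R\<^esub> \<longrightarrow>
        r <#\<^bsub>R\<^esub> Rg (inv\<^bsub>G\<^esub> g) \<noteq> {\<zero>\<^bsub>R\<^esub>} \<and> Rg (inv\<^bsub>G\<^esub> g) #>\<^bsub>R\<^esub> r \<noteq> {\<zero>\<^bsub>R\<^esub>})"

text \<open>
  A subring \<open>S\<close> of \<open>R\<close>, not required to contain \<open>\<one>\<^bsub>R\<^esub>\<close> or to be commutative, is a domain.
  The library's \<open>subdomain\<close> would in addition presuppose \<open>\<one>\<^bsub>R\<^esub> \<in> S\<close>.
\<close>

definition domain_subring :: "'r set \<Rightarrow> ('r, 'n) ring_scheme \<Rightarrow> bool" where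
  "domain_subring S R \<longleftrightarrow>
     additive_subgroup S R \<and> S <#>\<^bsub>R\<^esub> S \<subseteq> S \<and> S \<noteq> {\<zero>\<^bsub>R\<^esub>} \<and>
     (\<forall>a\<in>S. \<forall>b\<in>S. a \<noteq> \<zero>\<^bsub>R\<^esub> \<longrightarrow> b \<noteq> \<zero>\<^bsub>R\<^esub> \<longrightarrow> a \<otimes>\<^bsub>R\<^esub> b \<noteq> \<zero>\<^bsub>R\<^esub>)"

definition idempotent_elem :: "('r, 'n) ring_scheme \<Rightarrow> 'r \<Rightarrow> bool" where
  "idempotent_elem R a \<longleftrightarrow> a \<in> carrier R \<and> a \<otimes>\<^bsub>R\<^esub> a = a"

end

theory Submission
  imports Defs
begin

text \<open>
  The group \<open>G\<close> need not be abelian, but the degrees that occur in \<open>R\<close> commute. Given nonzero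
  \<open>r \<in> R\<^sub>g\<close> and \<open>s \<in> R\<^sub>h\<close>, non-degeneracy supplies \<open>r'\<close> and \<open>s'\<close> of the inverse degrees such
  that \<open>r r'\<close> and \<open>s s'\<close> are nonzero elements of the domain \<open>R\<^sub>e\<close>. Since \<open>R\<close> is commutative,
  \<open>(r s) (r' s') = (r r') (s s') \<noteq> 0\<close>, so \<open>r s \<noteq> 0\<close> (\<open>homogeneous_prod_nonzero\<close>). Hence the set of
  degrees with a nonzero component is a subgroup \<open>H\<close> of \<open>G\<close>, and \<open>r s = s r\<close> is a nonzero element
  lying in both \<open>R\<^bsub>gh\<^esub>\<close> and \<open>R\<^bsub>hg\<^esub>\<close>, which forces \<open>g h = h g\<close> (\<open>degrees_commute\<close>).

  So \<open>H\<close> is a torsion-free abelian group. Such a group admits a translation-invariant total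
  order, and for finite sets \<open>A\<close> and \<open>B\<close> the product of the two least elements and the product of
  the two greatest elements are each attained only once in \<open>A B\<close> (\<open>two_unique_products\<close>). For nonzero
  \<open>r\<close> and \<open>s\<close>, taking \<open>A\<close> and \<open>B\<close> to be their supports, the component of \<open>r s\<close> in such a degree is
  a single product of nonzero homogeneous elements and therefore does not vanish. Thus \<open>r s \<noteq> 0\<close>,
  and \<open>R\<close> is a domain. If moreover \<open>r s = 1\<close>, then, as \<open>1 \<in> R\<^sub>e\<close>, the least and the greatest
  product both equal \<open>e\<close>, so they coincide and the support of \<open>r\<close> is a singleton: units are
  homogeneous. Idempotents of a domain are trivial.
\<close>

section \<open>Products in torsion-free abelian groups\<close>

lemma (in group) pow_mem_of_mult_closed:
  assumes "S \<subseteq> carrier G" and closed: "\<And>x y. \<lbrakk>x \<in> S; y \<in> S\<rbrakk> \<Longrightarrow> x \<otimes> y \<in> S"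
    and "s \<in> S" "0 < (k::nat)"
  shows "s [^] k \<in> S"
  using \<open>0 < k\<close>
proof (induction k rule: nat_induct_non_zero)
  case 1
  show ?case using assms by auto
next
  case (Suc k)
  then show ?case using assms by auto
qed

text \<open>
  The semigroup \<open>S\<close> plays the role of the positive elements of a translation-invariant order that
  compares finitely many prescribed elements with \<open>\<one>\<close>; working with finitely many elements at a
  time avoids Zorn's lemma. It is built by adjoining one element \<open>x\<close> or its inverse at a time. If
  both choices produced \<open>\<one>\<close>, then \<open>s x\<^sup>k = \<one>\<close> and \<open>t (x\<^sup>-\<^sup>1)\<^sup>l = \<one>\<close> with \<open>s, t \<in> S \<union> {\<one>}\<close>, so
  \<open>s\<^sup>l t\<^sup>k = \<one>\<close>; as \<open>\<one> \<notin> S\<close> this gives \<open>s = \<one>\<close> and \<open>x\<^sup>k = \<one>\<close>, contradicting torsion-freeness.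
\<close>

lemma (in comm_group) exists_positive_cone:
  assumes tf: "torsion_free_group G"
    and "finite T" and "T \<subseteq> carrier G - {\<one>}"
  obtains S where "S \<subseteq> carrier G" and "\<one> \<notin> S"
    and "\<And>x y. \<lbrakk>x \<in> S; y \<in> S\<rbrakk> \<Longrightarrow> x \<otimes> y \<in> S"
    and "\<And>x. x \<in> T \<Longrightarrow> x \<in> S \<or> inv x \<in> S"
proof -
  have "\<exists>S \<subseteq> carrier G. \<one> \<notin> S \<and> (\<forall>x\<in>S. \<forall>y\<in>S. x \<otimes> y \<in> S) \<and> (\<forall>x\<in>T. x \<in> S \<or> inv x \<in> S)"
    using assms(2,3)
  proof (induction T rule: finite_induct)
    case empty
    show ?case by (intro exI[of _ "{}"]) auto
  next
    case (insert x T)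
    then obtain S where S: "S \<subseteq> carrier G" "\<one> \<notin> S" "\<And>x y. \<lbrakk>x \<in> S; y \<in> S\<rbrakk> \<Longrightarrow> x \<otimes> y \<in> S"
      and T: "\<And>x. x \<in> T \<Longrightarrow> x \<in> S \<or> inv x \<in> S"
      by (metis insert_subset)
    have x: "x \<in> carrier G" "x \<noteq> \<one>"
      using insert.prems by auto
    \<comment> \<open>The semigroup generated by \<open>S\<close> and \<open>z\<close>. The side condition excludes only the empty
      product.\<close>
    define E where "E z = {s \<otimes> z [^] k | s (k::nat). s \<in> insert \<one> S \<and> (s \<noteq> \<one> \<or> 0 < k)}" for z
    have S1: "s \<in> carrier G" if "s \<in> insert \<one> S" for s
      using that S(1) by auto
    have E_carrier: "E z \<subseteq> carrier G" if "z \<in> carrier G" for z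
      using that S1 by (auto simp: E_def)
    have S_E: "S \<subseteq> E z" if "z \<in> carrier G" for z
    proof
      fix s assume "s \<in> S"
      then show "s \<in> E z"
        unfolding E_def using S(1,2)
        by (intro CollectI exI[of _ s] exI[of _ "0::nat"]) auto
    qed
    have z_E: "z \<in> E z" if "z \<in> carrier G" for z
      unfolding E_def using that
      by (intro CollectI exI[of _ \<one>] exI[of _ "1::nat"]) auto
    have E_mult: "a \<otimes> b \<in> E z" if zG: "z \<in> carrier G" and ab: "a \<in> E z" "b \<in> E z" for z a b
    proof -
      obtain s k where a: "a = s \<otimes> z [^] (k::nat)" "s \<in> insert \<one> S" "s \<noteq> \<one> \<or> 0 < k"
        using ab(1) unfolding E_def by auto
      obtain t l where b: "b = t \<otimes> z [^] (l::nat)" "t \<in> insert \<one> S" "t \<noteq> \<one> \<or> 0 < l"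
        using ab(2) unfolding E_def by auto
      have st: "s \<in> carrier G" "t \<in> carrier G"
        using a b S1 by auto
      have "a \<otimes> b = (s \<otimes> t) \<otimes> (z [^] k \<otimes> z [^] l)"
        using st zG by (simp add: a(1) b(1) m_ac)
      also have "z [^] k \<otimes> z [^] l = z [^] (k + l)"
        using zG by (simp add: nat_pow_mult)
      finally have "a \<otimes> b = (s \<otimes> t) \<otimes> z [^] (k + l)" .
      moreover have "s \<otimes> t \<noteq> \<one>" if "s \<in> S" "t \<in> S"
        using S(2,3) that by metis
      then have "s \<otimes> t \<in> insert \<one> S" and "s \<otimes> t \<noteq> \<one> \<or> 0 < k + l"
        using a(2,3) b(2,3) S by auto
      ultimately show ?thesis
        unfolding E_def by blast
    qed
    have "\<one> \<notin> E x \<or> \<one> \<notin> E (inv x)"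
    proof (rule ccontr)
      assume "\<not> ?thesis"
      then obtain s t k l where s: "\<one> = s \<otimes> x [^] (k::nat)" "s \<in> insert \<one> S" "s \<noteq> \<one> \<or> 0 < k"
        and t: "\<one> = t \<otimes> inv x [^] (l::nat)" "t \<in> insert \<one> S" "t \<noteq> \<one> \<or> 0 < l"
        unfolding E_def by blast
      have st: "s \<in> carrier G" "t \<in> carrier G"
        using s t S1 by auto
      have k: "0 < k" using s st by (cases "k = 0") auto
      have l: "0 < l" using t st by (cases "l = 0") auto
      have s_eq: "s = inv x [^] k"
        using s(1) st x(1) by (metis inv_equality nat_pow_closed nat_pow_inv)
      have t_eq: "t = x [^] l"
        using t(1) st x(1) by (metis inv_equality inv_inv nat_pow_closed nat_pow_inv inv_closed)
      \<comment> \<open>Raising to the powers \<open>l\<close> and \<open>k\<close> makes the exponents of \<open>x\<close> cancel.\<close>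
      have st_one: "s [^] l \<otimes> t [^] k = \<one>"
        using x(1) by (simp add: s_eq t_eq nat_pow_pow nat_pow_inv mult.commute)
      have "s = \<one>"
      proof (rule ccontr)
        assume "s \<noteq> \<one>"
        then have "s [^] l \<in> S"
          using s(2) S l pow_mem_of_mult_closed by blast
        moreover have "t [^] k \<in> insert \<one> S"
          using t(2) S k pow_mem_of_mult_closed by (cases "t = \<one>") auto
        ultimately have "s [^] l \<otimes> t [^] k \<in> S"
          using S by auto
        then show False using st_one S(2) by simp
      qed
      then have "x [^] k = \<one>"
        using s(1) x(1) by (metis l_one nat_pow_closed)
      then show False
        using tf k x unfolding torsion_free_group_def by blast
    qed
    then obtain z where z: "z = x \<or> z = inv x" "\<one> \<notin> E z"
      by blast
    then have zG: "z \<in> carrier G" using x by auto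
    have "y \<in> E z \<or> inv y \<in> E z" if "y \<in> insert x T" for y
      using that T S_E[OF zG] z_E[OF zG] z(1) by auto
    then show ?case
      using E_carrier[OF zG] z(2) E_mult[OF zG] by (intro exI[of _ "E z"]) auto
  qed
  then show thesis using that by metis
qed

definition unique_product :: "('g, 'm) monoid_scheme \<Rightarrow> 'g set \<Rightarrow> 'g set \<Rightarrow> 'g \<Rightarrow> 'g \<Rightarrow> bool" where
  "unique_product G A B a b \<longleftrightarrow> a \<in> A \<and> b \<in> B \<and>
     (\<forall>x\<in>A. \<forall>y\<in>B. x \<otimes>\<^bsub>G\<^esub> y = a \<otimes>\<^bsub>G\<^esub> b \<longrightarrow> x = a \<and> y = b)"

text \<open>
  The two pairs consist of the least and of the greatest elements of \<open>A\<close> and \<open>B\<close> for the order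
  given by a positive cone. The product of the two least elements is strictly smaller than
  any product in which a factor is not least, and dually for the greatest elements. If the least and the greatest
  element of \<open>A\<close> agree, then \<open>A\<close> has only one element.
\<close>

lemma (in comm_group) two_unique_products:
  assumes tf: "torsion_free_group G"
    and A: "finite A" "A \<noteq> {}" "A \<subseteq> carrier G"
    and B: "finite B" "B \<noteq> {}" "B \<subseteq> carrier G"
  obtains a b a' b' where "unique_product G A B a b" and "unique_product G A B a' b'"
    and "a \<noteq> a' \<or> A = {a}"
proof -
  \<comment> \<open>The quotients whose sign has to be known in order to compare all elements of \<open>A\<close> and \<open>B\<close>.\<close>
  define T where "T = (\<lambda>(x, y). inv x \<otimes> y) ` ((A \<union> B) \<times> (A \<union> B)) - {\<one>}"
  obtain S where S: "S \<subseteq> carrier G" "\<one> \<notin> S" "\<And>x y. \<lbrakk>x \<in> S; y \<in> S\<rbrakk> \<Longrightarrow> x \<otimes> y \<in> S"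
    and TS: "\<And>x. x \<in> T \<Longrightarrow> x \<in> S \<or> inv x \<in> S"
  proof (rule exists_positive_cone[OF tf])
    show "finite T"
      unfolding T_def using A(1) B(1) by simp
    have "A \<union> B \<subseteq> carrier G" using A(3) B(3) by simp
    then show "T \<subseteq> carrier G - {\<one>}"
      unfolding T_def by (auto dest: subsetD)
  qed blast
  define less where "less x y \<longleftrightarrow> inv x \<otimes> y \<in> S" for x y
  have less_mult: "x \<otimes> x' \<noteq> y \<otimes> y'" if "less x y" "less x' y'"
    "x \<in> carrier G" "y \<in> carrier G" "x' \<in> carrier G" "y' \<in> carrier G" for x y x' y'
  proof
    assume eq: "x \<otimes> x' = y \<otimes> y'"
    have "(inv x \<otimes> y) \<otimes> (inv x' \<otimes> y') = inv (x \<otimes> x') \<otimes> (y \<otimes> y')"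
      using that by (simp add: inv_mult m_ac)
    also have "\<dots> = \<one>"
      using that by (simp add: eq)
    finally show False
      using S that(1,2) unfolding less_def by metis
  qed
  have asym: "\<not> less y x" if "less x y" "x \<in> carrier G" "y \<in> carrier G" for x y
    using less_mult[of x y y x] that by (auto simp: m_comm)
  have trans: "less x z" if "less x y" "less y z"
    "x \<in> carrier G" "y \<in> carrier G" "z \<in> carrier G" for x y z
  proof -
    have "y \<otimes> (inv y \<otimes> z) = z"
      using that by (simp add: m_assoc[symmetric])
    then have "(inv x \<otimes> y) \<otimes> (inv y \<otimes> z) = inv x \<otimes> z"
      using that by (simp add: m_assoc)
    then show ?thesis
      using S(3) that(1,2) unfolding less_def by metis
  qed
  have total: "less x y \<or> less y x" if "x \<in> A \<union> B" "y \<in> A \<union> B" "x \<noteq> y" for x y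
  proof -
    have xy: "x \<in> carrier G" "y \<in> carrier G" using that A B by auto
    have "inv x \<otimes> y \<noteq> \<one>"
      using xy \<open>x \<noteq> y\<close> by (metis inv_equality inv_inv inv_closed)
    then have "inv x \<otimes> y \<in> T"
      unfolding T_def using that by auto
    moreover have "inv (inv x \<otimes> y) = inv y \<otimes> x"
      using xy by (simp add: inv_mult_group)
    ultimately show ?thesis
      using TS unfolding less_def by metis
  qed
  have ex: "(\<exists>m\<in>C. \<forall>c\<in>C. c \<noteq> m \<longrightarrow> less m c) \<and> (\<exists>m\<in>C. \<forall>c\<in>C. c \<noteq> m \<longrightarrow> less c m)"
    if "finite C" "C \<noteq> {}" "C \<subseteq> A \<union> B" for C
  proof -
    have CG: "C \<subseteq> carrier G" using that A B by auto
    have "transp_on C less"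
      using CG by (intro transp_onI) (rule trans, auto)
    moreover have "totalp_on C less"
      using that(3) by (intro totalp_onI total) auto
    ultimately show ?thesis
      by (intro conjI Finite_Set.bex_least_element Finite_Set.bex_greatest_element that(1,2))
  qed
  note ex_A = ex[OF A(1,2) Un_upper1] and ex_B = ex[OF B(1,2) Un_upper2]
  obtain a where a: "a \<in> A" "\<forall>x\<in>A. x \<noteq> a \<longrightarrow> less a x" using ex_A[THEN conjunct1] ..
  obtain a' where a': "a' \<in> A" "\<forall>x\<in>A. x \<noteq> a' \<longrightarrow> less x a'" using ex_A[THEN conjunct2] ..
  obtain b where b: "b \<in> B" "\<forall>x\<in>B. x \<noteq> b \<longrightarrow> less b x" using ex_B[THEN conjunct1] ..
  obtain b' where b': "b' \<in> B" "\<forall>x\<in>B. x \<noteq> b' \<longrightarrow> less x b'" using ex_B[THEN conjunct2] ..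
  have G: "\<And>x. x \<in> A \<Longrightarrow> x \<in> carrier G" "\<And>x. x \<in> B \<Longrightarrow> x \<in> carrier G"
    using A B by auto
  have "unique_product G A B a b"
    unfolding unique_product_def
  proof (intro conjI ballI impI)
    fix x y assume xy: "x \<in> A" "y \<in> B" "x \<otimes> y = a \<otimes> b"
    have "x = a \<longleftrightarrow> y = b"
      using xy a(1) b(1) G by (metis l_cancel r_cancel)
    moreover have "x = a \<or> y = b"
      using less_mult[of a x b y] a b xy G by metis
    ultimately show "x = a" "y = b" by auto
  qed (use a b in auto)
  moreover have "unique_product G A B a' b'"
    unfolding unique_product_def
  proof (intro conjI ballI impI)
    fix x y assume xy: "x \<in> A" "y \<in> B" "x \<otimes> y = a' \<otimes> b'"
    have "x = a' \<longleftrightarrow> y = b'"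
      using xy a'(1) b'(1) G by (metis l_cancel r_cancel)
    moreover have "x = a' \<or> y = b'"
      using less_mult[of x a' y b'] a' b' xy G by metis
    ultimately show "x = a'" "y = b'" by auto
  qed (use a' b' in auto)
  moreover have "a \<noteq> a' \<or> A = {a}"
    using a a' asym G by blast
  ultimately show thesis using that by blast
qed

section \<open>Homogeneous components\<close>

text \<open>
  The prefixes keep apart the facts about the group and about the ring, whose names clash in
  \<open>graded_ring\<close>.
\<close>

locale group_graded_ring = G: group G + R: ring R + graded_ring G R Rg
  for G :: "('g, 'm) monoid_scheme" and R :: "('r, 'n) ring_scheme" and Rg
begin

definition decomposition :: "'r \<Rightarrow> 'g \<Rightarrow> 'r" where
  "decomposition r = (THE f. f \<in> (\<Pi>\<^sub>E g\<in>carrier G. Rg g) \<and> finite (support_of G R f) \<and>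
     r = (\<Oplus>\<^bsub>R\<^esub>g\<in>support_of G R f. f g))"

abbreviation supp :: "'r \<Rightarrow> 'g set" where
  "supp r \<equiv> support_of G R (decomposition r)"

lemma component_carrier: "\<lbrakk>g \<in> carrier G; r \<in> Rg g\<rbrakk> \<Longrightarrow> r \<in> carrier R"
  using additive_subgroup.a_subset[OF component_subgroup, of g] by (rule subsetD)

lemma component_zero: "g \<in> carrier G \<Longrightarrow> \<zero>\<^bsub>R\<^esub> \<in> Rg g"
  by (rule additive_subgroup.zero_closed[OF component_subgroup])

lemma component_add: "\<lbrakk>g \<in> carrier G; r \<in> Rg g; s \<in> Rg g\<rbrakk> \<Longrightarrow> r \<oplus>\<^bsub>R\<^esub> s \<in> Rg g"
  by (rule additive_subgroup.a_closed[OF component_subgroup])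

lemma component_prod:
  "\<lbrakk>g \<in> carrier G; h \<in> carrier G; r \<in> Rg g; s \<in> Rg h\<rbrakk> \<Longrightarrow> r \<otimes>\<^bsub>R\<^esub> s \<in> Rg (g \<otimes>\<^bsub>G\<^esub> h)"
  by (rule subsetD[OF component_mult]) (auto simp: set_mult_def)

lemma decomposition:
  assumes "r \<in> carrier R"
  shows "decomposition r \<in> (\<Pi>\<^sub>E g\<in>carrier G. Rg g)" "finite (supp r)"
    "(\<Oplus>\<^bsub>R\<^esub>g\<in>supp r. decomposition r g) = r"
  using theI'[OF direct_sum[OF assms], folded decomposition_def] by simp_all

lemma decomposition_component:
  "\<lbrakk>r \<in> carrier R; g \<in> carrier G\<rbrakk> \<Longrightarrow> decomposition r g \<in> Rg g"
  using decomposition(1) by (auto simp: PiE_iff)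

lemma decomposition_closed [simp]:
  "\<lbrakk>r \<in> carrier R; g \<in> carrier G\<rbrakk> \<Longrightarrow> decomposition r g \<in> carrier R"
  by (rule component_carrier[OF _ decomposition_component])

lemma supp_carrier: "supp r \<subseteq> carrier G"
  by (auto simp: support_of_def)

lemma supp_memD: "g \<in> supp r \<Longrightarrow> g \<in> carrier G"
  using supp_carrier by blast

lemma finsum_superset:
  assumes "finite A" "support_of G R f \<subseteq> A" "A \<subseteq> carrier G" "f \<in> A \<rightarrow> carrier R"
  shows "(\<Oplus>\<^bsub>R\<^esub>g\<in>support_of G R f. f g) = (\<Oplus>\<^bsub>R\<^esub>g\<in>A. f g)"
  using assms by (intro R.add.finprod_mono_neutral_cong_left) (auto simp: support_of_def)

lemma decomposition_sum:
  assumes "r \<in> carrier R" "finite A" "supp r \<subseteq> A" "A \<subseteq> carrier G"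
  shows "(\<Oplus>\<^bsub>R\<^esub>g\<in>A. decomposition r g) = r"
  using decomposition(3)[OF assms(1)] finsum_superset[OF assms(2-4)] assms by (auto simp: Pi_iff subset_iff)

text \<open>
  The set \<open>A\<close> may be larger than the support, so that a sum of homogeneous elements can be recognised
  as a decomposition without knowing which of its terms vanish.
\<close>

lemma decomposition_unique:
  assumes A: "finite A" "A \<subseteq> carrier G"
    and f: "\<And>g. g \<in> carrier G \<Longrightarrow> f g \<in> Rg g" "\<And>g. g \<in> carrier G - A \<Longrightarrow> f g = \<zero>\<^bsub>R\<^esub>"
    and r: "r = (\<Oplus>\<^bsub>R\<^esub>g\<in>A. f g)" and g: "g \<in> carrier G"
  shows "decomposition r g = f g"
proof -
  let ?f = "restrict f (carrier G)"
  have fR: "f \<in> A \<rightarrow> carrier R"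
    using f(1) A(2) component_carrier by (intro Pi_I) (metis subsetD)
  then have rR: "r \<in> carrier R"
    unfolding r by (rule R.finsum_closed)
  have supp: "support_of G R ?f \<subseteq> A"
    using f(2) by (auto simp: support_of_def)
  have "r = (\<Oplus>\<^bsub>R\<^esub>g\<in>A. ?f g)"
    unfolding r using A fR by (intro R.finsum_cong') auto
  also have "\<dots> = (\<Oplus>\<^bsub>R\<^esub>g\<in>support_of G R ?f. ?f g)"
    using finsum_superset[OF A(1) supp A(2)] fR A(2) by (auto simp: Pi_iff subset_iff)
  finally have "?f \<in> (\<Pi>\<^sub>E g\<in>carrier G. Rg g) \<and> finite (support_of G R ?f) \<and>
      r = (\<Oplus>\<^bsub>R\<^esub>g\<in>support_of G R ?f. ?f g)"
    using f(1) finite_subset[OF supp A(1)] by auto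
  then have "decomposition r = ?f"
    using direct_sum[OF rR] decomposition(3)[OF rR, symmetric] decomposition[OF rR] by metis
  then show ?thesis using g by simp
qed

lemma decomposition_homogeneous:
  assumes "h \<in> carrier G" "r \<in> Rg h" "g \<in> carrier G"
  shows "decomposition r g = (if g = h then r else \<zero>\<^bsub>R\<^esub>)"
proof (rule decomposition_unique[where A = "{h}" and f = "\<lambda>g. if g = h then r else \<zero>\<^bsub>R\<^esub>"])
  show "r = (\<Oplus>\<^bsub>R\<^esub>g\<in>{h}. if g = h then r else \<zero>\<^bsub>R\<^esub>)"
    using component_carrier[OF assms(1,2)] by simp
qed (use assms component_zero in auto)

lemma decomposition_add:
  assumes "r \<in> carrier R" "s \<in> carrier R" "g \<in> carrier G"
  shows "decomposition (r \<oplus>\<^bsub>R\<^esub> s) g = decomposition r g \<oplus>\<^bsub>R\<^esub> decomposition s g"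
proof (rule decomposition_unique[where A = "supp r \<union> supp s"])
  have "(\<Oplus>\<^bsub>R\<^esub>g\<in>supp r \<union> supp s. decomposition r g \<oplus>\<^bsub>R\<^esub> decomposition s g) =
      (\<Oplus>\<^bsub>R\<^esub>g\<in>supp r \<union> supp s. decomposition r g) \<oplus>\<^bsub>R\<^esub>
      (\<Oplus>\<^bsub>R\<^esub>g\<in>supp r \<union> supp s. decomposition s g)"
    using assms by (intro R.finsum_addf) (auto dest: supp_memD)
  also have "\<dots> = r \<oplus>\<^bsub>R\<^esub> s"
    using decomposition_sum[of r "supp r \<union> supp s"] decomposition_sum[of s "supp r \<union> supp s"]
      assms decomposition(2) supp_carrier by auto
  finally show "r \<oplus>\<^bsub>R\<^esub> s =
      (\<Oplus>\<^bsub>R\<^esub>g\<in>supp r \<union> supp s. decomposition r g \<oplus>\<^bsub>R\<^esub> decomposition s g)" ..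
qed (use assms decomposition(2) supp_carrier component_add decomposition_component
      in \<open>auto simp: support_of_def\<close>)

lemma decomposition_finsum:
  assumes "finite I" "\<And>i. i \<in> I \<Longrightarrow> f i \<in> carrier R" "g \<in> carrier G"
  shows "decomposition (\<Oplus>\<^bsub>R\<^esub>i\<in>I. f i) g = (\<Oplus>\<^bsub>R\<^esub>i\<in>I. decomposition (f i) g)"
  using assms(1,2)
proof (induction I rule: finite_induct)
  case empty
  show ?case
    using decomposition_homogeneous[OF assms(3) component_zero[OF assms(3)] assms(3)] by simp
next
  case (insert i I)
  have "(\<Oplus>\<^bsub>R\<^esub>i\<in>insert i I. f i) = f i \<oplus>\<^bsub>R\<^esub> (\<Oplus>\<^bsub>R\<^esub>i\<in>I. f i)"
    using insert by (intro R.finsum_insert) auto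
  moreover have "(\<Oplus>\<^bsub>R\<^esub>i\<in>insert i I. decomposition (f i) g) =
      decomposition (f i) g \<oplus>\<^bsub>R\<^esub> (\<Oplus>\<^bsub>R\<^esub>i\<in>I. decomposition (f i) g)"
    using insert assms(3) by (intro R.finsum_insert) auto
  moreover have "(\<Oplus>\<^bsub>R\<^esub>i\<in>I. f i) \<in> carrier R"
    using insert by (intro R.finsum_closed) auto
  ultimately show ?case
    using insert assms(3) by (simp add: decomposition_add)
qed

text \<open>
  Left multiplication by an element of degree \<open>h\<close> shifts all degrees by \<open>h\<close>, and distinct degrees
  stay distinct because \<open>G\<close> is cancellative.
\<close>

lemma decomposition_mult_homogeneous:
  assumes h: "h \<in> carrier G" "r \<in> Rg h" and s: "s \<in> carrier R" and g: "g \<in> carrier G"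
  shows "decomposition (r \<otimes>\<^bsub>R\<^esub> s) (h \<otimes>\<^bsub>G\<^esub> g) = r \<otimes>\<^bsub>R\<^esub> decomposition s g"
proof -
  let ?A = "insert g (supp s)"
  have A: "finite ?A" "?A \<subseteq> carrier G" "supp s \<subseteq> ?A"
    using decomposition(2)[OF s] supp_carrier g by auto
  have r: "r \<in> carrier R" using component_carrier[OF h] .
  have prod_in: "r \<otimes>\<^bsub>R\<^esub> decomposition s x \<in> Rg (h \<otimes>\<^bsub>G\<^esub> x)" if "x \<in> carrier G" for x
    using component_prod[OF h(1) that h(2) decomposition_component[OF s that]] .
  have "r \<otimes>\<^bsub>R\<^esub> s = r \<otimes>\<^bsub>R\<^esub> (\<Oplus>\<^bsub>R\<^esub>x\<in>?A. decomposition s x)"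
    using decomposition_sum[OF s A(1,3,2)] by simp
  also have "\<dots> = (\<Oplus>\<^bsub>R\<^esub>x\<in>?A. r \<otimes>\<^bsub>R\<^esub> decomposition s x)"
    using A r s by (intro R.finsum_rdistr) auto
  finally have "decomposition (r \<otimes>\<^bsub>R\<^esub> s) (h \<otimes>\<^bsub>G\<^esub> g) =
      (\<Oplus>\<^bsub>R\<^esub>x\<in>?A. decomposition (r \<otimes>\<^bsub>R\<^esub> decomposition s x) (h \<otimes>\<^bsub>G\<^esub> g))"
    using A(1,2) r s h g by (subst decomposition_finsum[symmetric]) (auto simp: subset_iff)
  also have "\<dots> = (\<Oplus>\<^bsub>R\<^esub>x\<in>?A. if g = x then r \<otimes>\<^bsub>R\<^esub> decomposition s x else \<zero>\<^bsub>R\<^esub>)"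
  proof (rule R.finsum_cong'[OF refl])
    fix x assume "x \<in> ?A"
    then have x: "x \<in> carrier G" using A(2) by blast
    show "decomposition (r \<otimes>\<^bsub>R\<^esub> decomposition s x) (h \<otimes>\<^bsub>G\<^esub> g) =
        (if g = x then r \<otimes>\<^bsub>R\<^esub> decomposition s x else \<zero>\<^bsub>R\<^esub>)"
      using decomposition_homogeneous[OF _ prod_in[OF x], of "h \<otimes>\<^bsub>G\<^esub> g"] x g h by simp
  qed (use A(2) r s in auto)
  also have "\<dots> = r \<otimes>\<^bsub>R\<^esub> decomposition s g"
    using A(1,2) r s by (intro R.finsum_singleton) auto
  finally show ?thesis .
qed

text \<open>
  Comparing degrees in \<open>r \<one> = r\<close> for homogeneous \<open>r\<close> shows that every component of \<open>\<one>\<close> outside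
  degree \<open>e\<close> is annihilated by \<open>r\<close>. Summing over the components \<open>r\<close> of \<open>\<one>\<close>, it is annihilated by
  \<open>\<one>\<close>.
\<close>

lemma one_in_component: "\<one>\<^bsub>R\<^esub> \<in> Rg \<one>\<^bsub>G\<^esub>"
proof -
  have zero: "decomposition \<one>\<^bsub>R\<^esub> g = \<zero>\<^bsub>R\<^esub>" if g: "g \<in> carrier G" "g \<noteq> \<one>\<^bsub>G\<^esub>" for g
  proof -
    let ?c = "decomposition \<one>\<^bsub>R\<^esub>"
    have "?c h \<otimes>\<^bsub>R\<^esub> ?c g = \<zero>\<^bsub>R\<^esub>" if h: "h \<in> carrier G" for h
    proof -
      have ch: "?c h \<in> Rg h" using decomposition_component h by simp
      have "?c h \<otimes>\<^bsub>R\<^esub> ?c g = decomposition (?c h \<otimes>\<^bsub>R\<^esub> \<one>\<^bsub>R\<^esub>) (h \<otimes>\<^bsub>G\<^esub> g)"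
        using decomposition_mult_homogeneous[OF h ch _ g(1), of "\<one>\<^bsub>R\<^esub>"] by simp
      also have "\<dots> = \<zero>\<^bsub>R\<^esub>"
        using decomposition_homogeneous[OF h ch, of "h \<otimes>\<^bsub>G\<^esub> g"] h g by simp
      finally show ?thesis .
    qed
    then have "(\<Oplus>\<^bsub>R\<^esub>h\<in>supp \<one>\<^bsub>R\<^esub>. ?c h \<otimes>\<^bsub>R\<^esub> ?c g) = \<zero>\<^bsub>R\<^esub>"
      by (intro R.add.finprod_one_eqI) (auto dest: supp_memD)
    moreover have "(\<Oplus>\<^bsub>R\<^esub>h\<in>supp \<one>\<^bsub>R\<^esub>. ?c h \<otimes>\<^bsub>R\<^esub> ?c g) = (\<Oplus>\<^bsub>R\<^esub>h\<in>supp \<one>\<^bsub>R\<^esub>. ?c h) \<otimes>\<^bsub>R\<^esub> ?c g"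
      using decomposition(2) g by (intro R.finsum_ldistr[symmetric]) (auto dest: supp_memD)
    ultimately show ?thesis
      using decomposition(3)[of "\<one>\<^bsub>R\<^esub>"] g by simp
  qed
  then have "supp \<one>\<^bsub>R\<^esub> \<subseteq> {\<one>\<^bsub>G\<^esub>}"
    by (auto simp: support_of_def)
  then have "\<one>\<^bsub>R\<^esub> = (\<Oplus>\<^bsub>R\<^esub>g\<in>{\<one>\<^bsub>G\<^esub>}. decomposition \<one>\<^bsub>R\<^esub> g)"
    by (intro decomposition_sum[symmetric]) auto
  also have "\<dots> = decomposition \<one>\<^bsub>R\<^esub> \<one>\<^bsub>G\<^esub>"
    by simp
  finally have "decomposition \<one>\<^bsub>R\<^esub> \<one>\<^bsub>G\<^esub> = \<one>\<^bsub>R\<^esub>" ..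
  then show ?thesis
    using decomposition_component[of "\<one>\<^bsub>R\<^esub>" "\<one>\<^bsub>G\<^esub>"] by simp
qed

lemma decomposition_mult_unique_product:
  assumes r: "r \<in> carrier R" and s: "s \<in> carrier R"
    and uniq: "unique_product G (supp r) (supp s) a b"
  shows "decomposition (r \<otimes>\<^bsub>R\<^esub> s) (a \<otimes>\<^bsub>G\<^esub> b) = decomposition r a \<otimes>\<^bsub>R\<^esub> decomposition s b"
proof -
  have ab: "a \<in> supp r" "b \<in> supp s"
    and eq: "\<And>x y. \<lbrakk>x \<in> supp r; y \<in> supp s; x \<otimes>\<^bsub>G\<^esub> y = a \<otimes>\<^bsub>G\<^esub> b\<rbrakk> \<Longrightarrow> x = a \<and> y = b"
    using uniq unfolding unique_product_def by auto
  have G: "a \<in> carrier G" "b \<in> carrier G" "a \<otimes>\<^bsub>G\<^esub> b \<in> carrier G"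
    using ab supp_carrier by auto
  have "r \<otimes>\<^bsub>R\<^esub> s = (\<Oplus>\<^bsub>R\<^esub>x\<in>supp r. decomposition r x) \<otimes>\<^bsub>R\<^esub> s"
    using decomposition(3)[OF r] by simp
  also have "\<dots> = (\<Oplus>\<^bsub>R\<^esub>x\<in>supp r. decomposition r x \<otimes>\<^bsub>R\<^esub> s)"
    using decomposition(2)[OF r] r s by (intro R.finsum_ldistr) (auto dest: supp_memD)
  finally have "decomposition (r \<otimes>\<^bsub>R\<^esub> s) (a \<otimes>\<^bsub>G\<^esub> b) =
      (\<Oplus>\<^bsub>R\<^esub>x\<in>supp r. decomposition (decomposition r x \<otimes>\<^bsub>R\<^esub> s) (a \<otimes>\<^bsub>G\<^esub> b))"
    using decomposition(2)[OF r] r s G(3)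
    by (subst decomposition_finsum[symmetric]) (auto simp: support_of_def)
  also have "\<dots> = (\<Oplus>\<^bsub>R\<^esub>x\<in>supp r. if a = x then decomposition r x \<otimes>\<^bsub>R\<^esub> decomposition s b else \<zero>\<^bsub>R\<^esub>)"
  proof (rule R.finsum_cong'[OF refl])
    fix x assume x: "x \<in> supp r"
    then have xG: "x \<in> carrier G" using supp_carrier by blast
    \<comment> \<open>The degree that a component of \<open>s\<close> must have to be carried into degree \<open>a b\<close> by \<open>r\<^sub>x\<close>.\<close>
    define y where "y = inv\<^bsub>G\<^esub> x \<otimes>\<^bsub>G\<^esub> (a \<otimes>\<^bsub>G\<^esub> b)"
    have y: "y \<in> carrier G" "x \<otimes>\<^bsub>G\<^esub> y = a \<otimes>\<^bsub>G\<^esub> b"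
      using xG G unfolding y_def by (simp_all add: G.m_assoc[symmetric])
    have "decomposition (decomposition r x \<otimes>\<^bsub>R\<^esub> s) (a \<otimes>\<^bsub>G\<^esub> b) = decomposition r x \<otimes>\<^bsub>R\<^esub> decomposition s y"
      using decomposition_mult_homogeneous[OF xG decomposition_component[OF r xG] s y(1)] y(2) by simp
    also have "\<dots> = (if a = x then decomposition r x \<otimes>\<^bsub>R\<^esub> decomposition s b else \<zero>\<^bsub>R\<^esub>)"
    proof (cases "a = x")
      case True
      then have "y = b" using y G by simp
      then show ?thesis using True by simp
    next
      case False
      then have "y \<notin> supp s" using eq x y(2) by blast
      then have "decomposition s y = \<zero>\<^bsub>R\<^esub>" using y(1) by (simp add: support_of_def)
      then show ?thesis using False r xG by simp
    qed
    finally show "decomposition (decomposition r x \<otimes>\<^bsub>R\<^esub> s) (a \<otimes>\<^bsub>G\<^esub> b) =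
        (if a = x then decomposition r x \<otimes>\<^bsub>R\<^esub> decomposition s b else \<zero>\<^bsub>R\<^esub>)" .
  qed (use r s G in \<open>auto dest: supp_memD\<close>)
  also have "\<dots> = decomposition r a \<otimes>\<^bsub>R\<^esub> decomposition s b"
    using ab decomposition(2)[OF r] r s G by (intro R.finsum_singleton) (auto dest: supp_memD)
  finally show ?thesis .
qed

lemma supp_nonempty:
  assumes "r \<in> carrier R" "r \<noteq> \<zero>\<^bsub>R\<^esub>"
  shows "supp r \<noteq> {}"
  using decomposition(3)[OF assms(1)] assms(2) by auto

end

section \<open>Non-degenerate gradings with a domain in degree one\<close>

locale nondegenerate_graded_ring = group_graded_ring G R Rg + R: cring R
  for G :: "('g, 'm) monoid_scheme" and R :: "('r, 'n) ring_scheme" and Rg +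
  assumes torsion_free: "torsion_free_group G"
    and nondegenerate: "nondegenerate_grading G R Rg"
    and domain_one: "domain_subring (Rg \<one>\<^bsub>G\<^esub>) R"
begin

lemma nondegenerate_right:
  assumes g: "g \<in> carrier G" and r: "r \<in> Rg g" "r \<noteq> \<zero>\<^bsub>R\<^esub>"
  obtains s where "s \<in> Rg (inv\<^bsub>G\<^esub> g)" "r \<otimes>\<^bsub>R\<^esub> s \<in> Rg \<one>\<^bsub>G\<^esub>" "r \<otimes>\<^bsub>R\<^esub> s \<noteq> \<zero>\<^bsub>R\<^esub>"
proof -
  have ne: "r <#\<^bsub>R\<^esub> Rg (inv\<^bsub>G\<^esub> g) \<noteq> {\<zero>\<^bsub>R\<^esub>}"
    using nondegenerate g r unfolding nondegenerate_grading_def by blast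
  have "r \<otimes>\<^bsub>R\<^esub> \<zero>\<^bsub>R\<^esub> = \<zero>\<^bsub>R\<^esub>"
    using component_carrier[OF g r(1)] by simp
  then obtain s where s: "s \<in> Rg (inv\<^bsub>G\<^esub> g)" "r \<otimes>\<^bsub>R\<^esub> s \<noteq> \<zero>\<^bsub>R\<^esub>"
    using ne component_zero[of "inv\<^bsub>G\<^esub> g"] g unfolding l_coset_def by fastforce
  moreover have "r \<otimes>\<^bsub>R\<^esub> s \<in> Rg \<one>\<^bsub>G\<^esub>"
    using component_prod[of g "inv\<^bsub>G\<^esub> g" r s] g r s by simp
  ultimately show thesis using that by blast
qed

text \<open>
  Completing \<open>r\<close> and \<open>s\<close> to nonzero elements \<open>r r'\<close> and \<open>s s'\<close> of degree \<open>e\<close> moves the question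
  into the domain \<open>R\<^sub>e\<close>, where \<open>(r r') (s s') = (r s) (r' s')\<close> cannot vanish.
\<close>

lemma homogeneous_prod_nonzero:
  assumes g: "g \<in> carrier G" "r \<in> Rg g" "r \<noteq> \<zero>\<^bsub>R\<^esub>"
    and h: "h \<in> carrier G" "s \<in> Rg h" "s \<noteq> \<zero>\<^bsub>R\<^esub>"
  shows "r \<otimes>\<^bsub>R\<^esub> s \<noteq> \<zero>\<^bsub>R\<^esub>"
proof
  assume zero: "r \<otimes>\<^bsub>R\<^esub> s = \<zero>\<^bsub>R\<^esub>"
  obtain r' where r': "r' \<in> Rg (inv\<^bsub>G\<^esub> g)" "r \<otimes>\<^bsub>R\<^esub> r' \<in> Rg \<one>\<^bsub>G\<^esub>" "r \<otimes>\<^bsub>R\<^esub> r' \<noteq> \<zero>\<^bsub>R\<^esub>"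
    using nondegenerate_right[OF g] .
  obtain s' where s': "s' \<in> Rg (inv\<^bsub>G\<^esub> h)" "s \<otimes>\<^bsub>R\<^esub> s' \<in> Rg \<one>\<^bsub>G\<^esub>" "s \<otimes>\<^bsub>R\<^esub> s' \<noteq> \<zero>\<^bsub>R\<^esub>"
    using nondegenerate_right[OF h] .
  have R: "r \<in> carrier R" "s \<in> carrier R" "r' \<in> carrier R" "s' \<in> carrier R"
    using g(1,2) h(1,2) r'(1) s'(1) by (simp_all add: component_carrier[of g] component_carrier[of h]
        component_carrier[of "inv\<^bsub>G\<^esub> g"] component_carrier[of "inv\<^bsub>G\<^esub> h"])
  have "(r \<otimes>\<^bsub>R\<^esub> r') \<otimes>\<^bsub>R\<^esub> (s \<otimes>\<^bsub>R\<^esub> s') = (r \<otimes>\<^bsub>R\<^esub> s) \<otimes>\<^bsub>R\<^esub> (r' \<otimes>\<^bsub>R\<^esub> s')"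
    using R by (simp add: R.m_ac)
  also have "\<dots> = \<zero>\<^bsub>R\<^esub>"
    using R zero by simp
  finally show False
    using domain_one r' s' unfolding domain_subring_def by blast
qed

definition degrees :: "'g set" where
  "degrees = {g \<in> carrier G. Rg g \<noteq> {\<zero>\<^bsub>R\<^esub>}}"

lemma degreesE:
  assumes "g \<in> degrees"
  obtains r where "g \<in> carrier G" "r \<in> Rg g" "r \<noteq> \<zero>\<^bsub>R\<^esub>"
proof -
  have g: "g \<in> carrier G" "Rg g \<noteq> {\<zero>\<^bsub>R\<^esub>}"
    using assms by (simp_all add: degrees_def)
  then show thesis
    using component_zero[OF g(1)] that[OF g(1)] by blast
qed

lemma degreesI: "\<lbrakk>g \<in> carrier G; r \<in> Rg g; r \<noteq> \<zero>\<^bsub>R\<^esub>\<rbrakk> \<Longrightarrow> g \<in> degrees"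
  unfolding degrees_def by blast

lemma supp_degrees: "r \<in> carrier R \<Longrightarrow> supp r \<subseteq> degrees"
  using degreesI[OF _ decomposition_component] by (auto simp: support_of_def)

lemma degrees_subgroup: "subgroup degrees G"
proof (rule G.subgroupI)
  show "degrees \<subseteq> carrier G"
    unfolding degrees_def by blast
  show "degrees \<noteq> {}"
    using domain_one unfolding degrees_def domain_subring_def by blast
  show "inv\<^bsub>G\<^esub> g \<in> degrees" if deg: "g \<in> degrees" for g
  proof -
    obtain r where g: "g \<in> carrier G" and r: "r \<in> Rg g" "r \<noteq> \<zero>\<^bsub>R\<^esub>"
      using degreesE[OF deg] .
    obtain s where "s \<in> Rg (inv\<^bsub>G\<^esub> g)" "r \<otimes>\<^bsub>R\<^esub> s \<noteq> \<zero>\<^bsub>R\<^esub>"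
      using nondegenerate_right[OF g r] .
    moreover from this have "s \<noteq> \<zero>\<^bsub>R\<^esub>"
      using component_carrier[OF g r(1)] by auto
    ultimately show ?thesis
      using g degreesI[of "inv\<^bsub>G\<^esub> g" s] by simp
  qed
  show "g \<otimes>\<^bsub>G\<^esub> h \<in> degrees" if gh: "g \<in> degrees" "h \<in> degrees" for g h
  proof -
    obtain r where r: "g \<in> carrier G" "r \<in> Rg g" "r \<noteq> \<zero>\<^bsub>R\<^esub>"
      using degreesE[OF gh(1)] .
    obtain s where s: "h \<in> carrier G" "s \<in> Rg h" "s \<noteq> \<zero>\<^bsub>R\<^esub>"
      using degreesE[OF gh(2)] .
    show ?thesis
      using degreesI[of "g \<otimes>\<^bsub>G\<^esub> h" "r \<otimes>\<^bsub>R\<^esub> s"] component_prod[of g h r s]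
        homogeneous_prod_nonzero[OF r s] r s by simp
  qed
qed

text \<open>
  A nonzero element lies in at most one component, while commutativity of \<open>R\<close> puts \<open>r s\<close> in the
  components of both \<open>g h\<close> and \<open>h g\<close>.
\<close>

lemma degrees_commute:
  assumes "g \<in> degrees" "h \<in> degrees"
  shows "g \<otimes>\<^bsub>G\<^esub> h = h \<otimes>\<^bsub>G\<^esub> g"
proof -
  obtain r where r: "g \<in> carrier G" "r \<in> Rg g" "r \<noteq> \<zero>\<^bsub>R\<^esub>"
    using degreesE[OF assms(1)] .
  obtain s where s: "h \<in> carrier G" "s \<in> Rg h" "s \<noteq> \<zero>\<^bsub>R\<^esub>"
    using degreesE[OF assms(2)] .
  have "r \<otimes>\<^bsub>R\<^esub> s = s \<otimes>\<^bsub>R\<^esub> r"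
    using component_carrier r s by (intro R.m_comm) auto
  then have "r \<otimes>\<^bsub>R\<^esub> s \<in> Rg (g \<otimes>\<^bsub>G\<^esub> h)" "r \<otimes>\<^bsub>R\<^esub> s \<in> Rg (h \<otimes>\<^bsub>G\<^esub> g)"
    using component_prod[of g h r s] component_prod[of h g s r] r s by simp_all
  then show ?thesis
    using decomposition_homogeneous[of "g \<otimes>\<^bsub>G\<^esub> h" "r \<otimes>\<^bsub>R\<^esub> s" "h \<otimes>\<^bsub>G\<^esub> g"]
      decomposition_homogeneous[of "h \<otimes>\<^bsub>G\<^esub> g" "r \<otimes>\<^bsub>R\<^esub> s" "h \<otimes>\<^bsub>G\<^esub> g"]
      homogeneous_prod_nonzero[OF r s] r s by (auto split: if_splits)
qed

text \<open>
  All supports lie in the torsion-free abelian group of degrees, so unique products exist there, and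
  in a degree that is a unique product no cancellation can occur. One such degree suffices for
  \<open>r s \<noteq> 0\<close>; the second one is what detects homogeneity of units.
\<close>

lemma prod_two_components:
  assumes r: "r \<in> carrier R" "r \<noteq> \<zero>\<^bsub>R\<^esub>" and s: "s \<in> carrier R" "s \<noteq> \<zero>\<^bsub>R\<^esub>"
  obtains a b a' b' where "unique_product G (supp r) (supp s) a b"
    and "unique_product G (supp r) (supp s) a' b'" and "a \<noteq> a' \<or> supp r = {a}"
    and "a \<otimes>\<^bsub>G\<^esub> b \<in> supp (r \<otimes>\<^bsub>R\<^esub> s)" and "a' \<otimes>\<^bsub>G\<^esub> b' \<in> supp (r \<otimes>\<^bsub>R\<^esub> s)"
proof -
  let ?H = "G\<lparr>carrier := degrees\<rparr>"
  interpret H: group ?H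
    using G.subgroup_imp_group[OF degrees_subgroup] .
  interpret H: comm_group ?H
    using degrees_commute by (intro H.group_comm_groupI) simp
  have tf: "torsion_free_group ?H"
    using torsion_free H.is_group subgroup.subset[OF degrees_subgroup]
    unfolding torsion_free_group_def by (auto simp: G.nat_pow_consistent[symmetric])
  have same: "unique_product ?H = unique_product G"
    by (simp add: unique_product_def fun_eq_iff)
  obtain a b a' b' where uniq: "unique_product G (supp r) (supp s) a b"
    "unique_product G (supp r) (supp s) a' b'" and single: "a \<noteq> a' \<or> supp r = {a}"
  proof (rule H.two_unique_products[OF tf, of "supp r" "supp s", unfolded same])
    show "supp r \<subseteq> carrier ?H" "supp s \<subseteq> carrier ?H"
      using supp_degrees r s by simp_all
  qed (use decomposition(2) supp_nonempty r s in auto)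
  have nz: "x \<otimes>\<^bsub>G\<^esub> y \<in> supp (r \<otimes>\<^bsub>R\<^esub> s)" if uniq: "unique_product G (supp r) (supp s) x y" for x y
  proof -
    have xy: "x \<in> carrier G" "y \<in> carrier G" "decomposition r x \<noteq> \<zero>\<^bsub>R\<^esub>" "decomposition s y \<noteq> \<zero>\<^bsub>R\<^esub>"
      using uniq unfolding unique_product_def support_of_def by auto
    have "decomposition r x \<otimes>\<^bsub>R\<^esub> decomposition s y \<noteq> \<zero>\<^bsub>R\<^esub>"
      using xy r s decomposition_component by (intro homogeneous_prod_nonzero[of x _ y]) auto
    then show ?thesis
      using decomposition_mult_unique_product[OF r(1) s(1) uniq] xy by (simp add: support_of_def)
  qed
  show thesis
    using that[OF uniq single nz[OF uniq(1)] nz[OF uniq(2)]] .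
qed

lemma domain_R: "domain R"
proof (rule domainI)
  show "cring R" by (rule R.is_cring)
  show "\<one>\<^bsub>R\<^esub> \<noteq> \<zero>\<^bsub>R\<^esub>"
  proof
    assume "\<one>\<^bsub>R\<^esub> = \<zero>\<^bsub>R\<^esub>"
    then have "carrier R = {\<zero>\<^bsub>R\<^esub>}" using R.one_zeroD by simp
    then have "Rg \<one>\<^bsub>G\<^esub> = {\<zero>\<^bsub>R\<^esub>}"
      using component_carrier[OF G.one_closed] component_zero[OF G.one_closed] by blast
    then show False using domain_one unfolding domain_subring_def by blast
  qed
  fix r s assume rs: "r \<otimes>\<^bsub>R\<^esub> s = \<zero>\<^bsub>R\<^esub>" "r \<in> carrier R" "s \<in> carrier R"
  show "r = \<zero>\<^bsub>R\<^esub> \<or> s = \<zero>\<^bsub>R\<^esub>"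
  proof (rule ccontr)
    assume "\<not> ?thesis"
    then have nz: "r \<noteq> \<zero>\<^bsub>R\<^esub>" "s \<noteq> \<zero>\<^bsub>R\<^esub>" by auto
    obtain c where "c \<in> supp (r \<otimes>\<^bsub>R\<^esub> s)"
      by (rule prod_two_components[OF rs(2) nz(1) rs(3) nz(2)])
    moreover have "supp \<zero>\<^bsub>R\<^esub> = {}"
      using decomposition_homogeneous[OF G.one_closed component_zero[OF G.one_closed]]
      by (auto simp: support_of_def)
    ultimately show False
      using rs(1) by simp
  qed
qed

text \<open>
  The product \<open>u v = \<one>\<close> has support \<open>{e}\<close>, so its two extremal degrees agree, and uniqueness of the
  factorisation makes the least and the greatest degree of \<open>u\<close> equal.
\<close>

lemma unit_homogeneous:
  assumes "u \<in> Units R"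
  shows "homogeneous G R Rg u"
proof -
  interpret D: domain R by (rule domain_R)
  obtain v where u: "u \<in> carrier R" and v: "v \<in> carrier R" and uv: "u \<otimes>\<^bsub>R\<^esub> v = \<one>\<^bsub>R\<^esub>"
    using assms unfolding Units_def by blast
  have nz: "u \<noteq> \<zero>\<^bsub>R\<^esub>" "v \<noteq> \<zero>\<^bsub>R\<^esub>"
    using uv u v D.one_not_zero by auto
  have supp_one: "c = \<one>\<^bsub>G\<^esub>" if "c \<in> supp (u \<otimes>\<^bsub>R\<^esub> v)" for c
    using that decomposition_homogeneous[OF _ one_in_component, of c]
    unfolding uv support_of_def by (auto split: if_splits)
  obtain a b a' b' where ab: "unique_product G (supp u) (supp v) a b"
    "unique_product G (supp u) (supp v) a' b'" and single: "a \<noteq> a' \<or> supp u = {a}"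
    and prods: "a \<otimes>\<^bsub>G\<^esub> b \<in> supp (u \<otimes>\<^bsub>R\<^esub> v)" "a' \<otimes>\<^bsub>G\<^esub> b' \<in> supp (u \<otimes>\<^bsub>R\<^esub> v)"
    using prod_two_components[OF u nz(1) v nz(2)] .
  have "a \<otimes>\<^bsub>G\<^esub> b = a' \<otimes>\<^bsub>G\<^esub> b'"
    using supp_one prods by metis
  then have "a = a'"
    using ab unfolding unique_product_def by metis
  then have supp: "supp u = {a}" using single by simp
  then have a: "a \<in> carrier G" using supp_carrier[of u] by blast
  have "decomposition u a = u"
    using decomposition(3)[OF u] u a unfolding supp by simp
  then have "u \<in> Rg a"
    using decomposition_component[OF u a] by simp
  then show ?thesis
    using u nz(1) a unfolding homogeneous_def by blast
qed

end

theorem corollary3p10: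
  fixes G :: "('g, 'm) monoid_scheme"
    and R :: "('r, 'n) ring_scheme"
    and Rg :: "'g \<Rightarrow> 'r set"
  assumes "torsion_free_group G"
    and "cring R"
    and "graded_ring G R Rg"
    and "nondegenerate_grading G R Rg"
    and "domain_subring (Rg \<one>\<^bsub>G\<^esub>) R"
  shows "(\<forall>u\<in>Units R. homogeneous G R Rg u) \<and>
         domain R \<and>
         (\<forall>a. idempotent_elem R a \<longrightarrow> a = \<zero>\<^bsub>R\<^esub> \<or> a = \<one>\<^bsub>R\<^esub>)"
proof -
  interpret nondegenerate_graded_ring G R Rg
    by (intro nondegenerate_graded_ring.intro group_graded_ring.intro
        nondegenerate_graded_ring_axioms.intro graded_ring.axioms(1,2)[OF assms(3)] assms)
  interpret D: domain R by (rule domain_R)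
  have "a = \<zero>\<^bsub>R\<^esub> \<or> a = \<one>\<^bsub>R\<^esub>" if "idempotent_elem R a" for a
  proof -
    have a: "a \<in> carrier R" "a \<otimes>\<^bsub>R\<^esub> a = a \<otimes>\<^bsub>R\<^esub> \<one>\<^bsub>R\<^esub>"
      using that unfolding idempotent_elem_def by simp_all
    then show ?thesis
      using D.m_lcancel[of a a "\<one>\<^bsub>R\<^esub>"] by auto
  qed
  then show ?thesis
    using unit_homogeneous domain_R by blast
qed

end
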